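(* Let $F$ be a dynamic forest on $n$ vertices with maximum degree $\Delta=2$, maintained with a proper $2$-edge-coloring. {\textsc{Greedy}} has $O(\log n)$ amortized recourse in the incremental model and $O(n)$ amortized recourse in the fully dynamic model. Both bounds are optimal up to a constant factor, even for randomized algorithms: any algorithm maintaining a proper $2$-edge-coloring has (expected) amortized recourse $\Omega(\log n)$ on some incremental sequence and $\Omega(n)$ on some fully dynamic sequence.
   Context: A dynamic forest on a fixed vertex set starts empty; in the incremental model each update inserts an edge joining two distinct trees; in the fully dynamic model updates may also delete edges; the maximum degree stays at most $\Delta$. Recourse of an update is the number of previously colored edges whose color changes (coloring the new edge does not count); amortized recourse is total recourse divided by number of updates. {\textsc{Greedy}}: upon insertion of $e$, recolor a smallest set of existing edges allowing $e$ to be colored (ties broken arbitrarily); upon deletion, keep the coloring. *)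

theory Defs
  imports "HOL-Probability.Probability"
begin

type_synonym edge = "nat set"
type_synonym coloring = "edge \<Rightarrow> nat"

datatype update = Insert edge | Delete edge

(* A graph on the vertex set {..<n} is given by its edge set alone. *)

definition same_tree :: "edge set \<Rightarrow> nat \<Rightarrow> nat \<Rightarrow> bool" where
  "same_tree E u v \<longleftrightarrow> (u, v) \<in> {(x, y). {x, y} \<in> E}\<^sup>*"

definition degree_at :: "edge set \<Rightarrow> nat \<Rightarrow> nat" where
  "degree_at E v = card {e \<in> E. v \<in> e}"

(* Acyclicity needs no separate condition: the empty graph is a forest, and being a forest is
   preserved by deletions and by insertions that join two distinct trees. The latter condition
   also rules out loops and edges already present. *)
fun valid_update :: "nat \<Rightarrow> nat \<Rightarrow> edge set \<Rightarrow> update \<Rightarrow> bool" where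
  "valid_update n \<Delta> E (Insert e) \<longleftrightarrow>
     (\<exists>u<n. \<exists>v<n. e = {u, v} \<and> \<not> same_tree E u v) \<and> (\<forall>w<n. degree_at (insert e E) w \<le> \<Delta>)"
| "valid_update n \<Delta> E (Delete e) \<longleftrightarrow> e \<in> E"

fun apply_update :: "update \<Rightarrow> edge set \<Rightarrow> edge set" where
  "apply_update (Insert e) E = insert e E"
| "apply_update (Delete e) E = E - {e}"

definition edges_after :: "update list \<Rightarrow> edge set" where
  "edges_after \<sigma> = fold apply_update \<sigma> {}"

definition fully_dynamic_seqs :: "nat \<Rightarrow> nat \<Rightarrow> update list set" where
  "fully_dynamic_seqs n \<Delta> =
     {\<sigma>. \<forall>i<length \<sigma>. valid_update n \<Delta> (edges_after (take i \<sigma>)) (\<sigma> ! i)}"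

definition incremental_seqs :: "nat \<Rightarrow> nat \<Rightarrow> update list set" where
  "incremental_seqs n \<Delta> = fully_dynamic_seqs n \<Delta> \<inter> {\<sigma>. set \<sigma> \<subseteq> range Insert}"

(* Values of a coloring outside the current edge set are irrelevant. *)
definition proper_coloring :: "nat \<Rightarrow> edge set \<Rightarrow> coloring \<Rightarrow> bool" where
  "proper_coloring k E c \<longleftrightarrow>
     (\<forall>e\<in>E. c e < k) \<and> (\<forall>e\<in>E. \<forall>f\<in>E. e \<noteq> f \<and> e \<inter> f \<noteq> {} \<longrightarrow> c e \<noteq> c f)"

(* Only edges present both before and after the update count; in particular neither a newly
   inserted nor a deleted edge does. *)
definition recourse :: "edge set \<Rightarrow> update \<Rightarrow> coloring \<Rightarrow> coloring \<Rightarrow> nat" where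
  "recourse E u c c' = card {f \<in> E \<inter> apply_update u E. c f \<noteq> c' f}"

(* Here c i is the coloring held after the first i updates. *)
definition total_recourse :: "update list \<Rightarrow> (nat \<Rightarrow> coloring) \<Rightarrow> nat" where
  "total_recourse \<sigma> c =
     (\<Sum>i<length \<sigma>. recourse (edges_after (take i \<sigma>)) (\<sigma> ! i) (c i) (c (Suc i)))"

definition amortized_recourse :: "update list \<Rightarrow> (nat \<Rightarrow> coloring) \<Rightarrow> real" where
  "amortized_recourse \<sigma> c = real (total_recourse \<sigma> c) / real (length \<sigma>)"

(* A relation rather than a function: ties between smallest sets of recolored edges (and the
   choice of the colors) are resolved arbitrarily. *)
fun greedy_step :: "nat \<Rightarrow> edge set \<Rightarrow> update \<Rightarrow> coloring \<Rightarrow> coloring \<Rightarrow> bool" where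
  "greedy_step k E (Insert e) c c' \<longleftrightarrow>
     is_arg_min (recourse E (Insert e) c) (proper_coloring k (insert e E)) c'"
| "greedy_step k E (Delete e) c c' \<longleftrightarrow> (\<forall>f\<in>E - {e}. c' f = c f)"

definition greedy_run :: "nat \<Rightarrow> update list \<Rightarrow> (nat \<Rightarrow> coloring) \<Rightarrow> bool" where
  "greedy_run k \<sigma> c \<longleftrightarrow>
     (\<forall>i<length \<sigma>. greedy_step k (edges_after (take i \<sigma>)) (\<sigma> ! i) (c i) (c (Suc i)))"

(* A deterministic online algorithm maps the updates seen so far to the current coloring. *)
type_synonym algorithm = "update list \<Rightarrow> coloring"

(* A randomized algorithm is a probability distribution over deterministic online algorithms; a
   deterministic one is a point mass. Correctness is only required on the sequences S of the
   model at hand. *)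
definition randomized_algorithm :: "nat \<Rightarrow> update list set \<Rightarrow> algorithm measure \<Rightarrow> bool" where
  "randomized_algorithm k S M \<longleftrightarrow>
     prob_space M \<and>
     (\<forall>\<sigma>\<in>S. \<forall>e\<in>edges_after \<sigma>. (\<lambda>A. A \<sigma> e) \<in> measurable M (count_space UNIV)) \<and>
     (\<forall>A\<in>space M. \<forall>\<sigma>\<in>S. proper_coloring k (edges_after \<sigma>) (A \<sigma>))"

(* The sequence is fixed independently of the random choices (oblivious adversary). *)
definition expected_amortized_recourse :: "algorithm measure \<Rightarrow> update list \<Rightarrow> real" where
  "expected_amortized_recourse M \<sigma> =
     (\<integral>A. amortized_recourse \<sigma> (\<lambda>i. A (take i \<sigma>)) \<partial>M)"

end

theory Submission
  imports Defs
begin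

text \<open>
  Greedy never recolors more than the smaller of the two trees it joins, since flipping one tree
  always suffices. In the incremental model an edge thus recolored ends up in a tree of at least
  twice the size, so it is recolored at most logarithmically often. In the fully dynamic model the
  number of edges is already a bound on the recourse.

  The lower bounds rest on a parity argument: a 2-coloring of a path is determined by one bit, and
  if two paths are joined in two ways that prescribe opposite relative colors, one of the joins
  forces all edges of one of the paths to be recolored. Incrementally, two paths
  \<open>P\<close>, \<open>Q\<close> with an odd number of vertices become either \<open>P @ [x] @ Q\<close> or \<open>P @ Q @ [x]\<close>; repeating
  this in a balanced binary fashion costs a linear amount on each of the logarithmically many
  levels. In the fully dynamic model the path \<open>P @ Q\<close> with an odd number of vertices is changed to
  \<open>Q @ P\<close> and back by exchanging a single edge of the underlying odd cycle.
\<close>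

section \<open>Update sequences and their recourse\<close>

lemma edges_after_Nil [simp]: "edges_after [] = {}"
  by (simp add: edges_after_def)

lemma edges_after_snoc [simp]: "edges_after (\<sigma> @ [u]) = apply_update u (edges_after \<sigma>)"
  by (simp add: edges_after_def)

lemma finite_edges_after [simp]: "finite (edges_after \<sigma>)"
proof (induction \<sigma> rule: rev_induct)
  case (snoc u \<sigma>)
  then show ?case by (cases u) auto
qed simp

lemma fully_dynamic_seqs_Nil [simp]: "[] \<in> fully_dynamic_seqs n \<Delta>"
  by (simp add: fully_dynamic_seqs_def)

lemma fully_dynamic_seqs_snoc [simp]:
  "\<sigma> @ [u] \<in> fully_dynamic_seqs n \<Delta> \<longleftrightarrow>
     \<sigma> \<in> fully_dynamic_seqs n \<Delta> \<and> valid_update n \<Delta> (edges_after \<sigma>) u"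
  by (auto simp: fully_dynamic_seqs_def less_Suc_eq nth_append)

lemma incremental_seqs_Nil [simp]: "[] \<in> incremental_seqs n \<Delta>"
  by (simp add: incremental_seqs_def)

lemma incremental_seqs_snoc [simp]:
  "\<sigma> @ [u] \<in> incremental_seqs n \<Delta> \<longleftrightarrow>
     \<sigma> \<in> incremental_seqs n \<Delta> \<and> u \<in> range Insert \<and> valid_update n \<Delta> (edges_after \<sigma>) u"
  by (auto simp: incremental_seqs_def)

lemma total_recourse_Nil [simp]: "total_recourse [] c = 0"
  by (simp add: total_recourse_def)

lemma total_recourse_snoc [simp]:
  "total_recourse (\<sigma> @ [u]) c = total_recourse \<sigma> c
     + recourse (edges_after \<sigma>) u (c (length \<sigma>)) (c (Suc (length \<sigma>)))"
  by (simp add: total_recourse_def nth_append)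

lemma greedy_run_snoc [simp]:
  "greedy_run k (\<sigma> @ [u]) c \<longleftrightarrow> greedy_run k \<sigma> c
     \<and> greedy_step k (edges_after \<sigma>) u (c (length \<sigma>)) (c (Suc (length \<sigma>)))"
  by (auto simp: greedy_run_def less_Suc_eq nth_append)

section \<open>Forests of maximum degree two\<close>

lemma same_tree_refl [simp]: "same_tree E u u"
  by (simp add: same_tree_def)

lemma same_tree_edge: "{u, v} \<in> E \<Longrightarrow> same_tree E u v"
  unfolding same_tree_def by (rule r_into_rtrancl) simp

lemma same_tree_trans: "same_tree E u v \<Longrightarrow> same_tree E v w \<Longrightarrow> same_tree E u w"
  by (auto simp: same_tree_def)

lemma same_tree_sym:
  assumes "same_tree E u v" shows "same_tree E v u"
proof -
  have "sym {(x, y). {x, y} \<in> E}"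
    by (auto simp: sym_def insert_commute)
  then have "sym ({(x, y). {x, y} \<in> E}\<^sup>*)"
    by (rule sym_rtrancl)
  then show ?thesis
    using assms by (auto simp: same_tree_def sym_def)
qed

lemma same_tree_mono: "same_tree E u v \<Longrightarrow> E \<subseteq> F \<Longrightarrow> same_tree F u v"
  unfolding same_tree_def by (erule rtrancl_mono[THEN subsetD, rotated]) auto

text \<open>Serves to certify that two vertices lie in distinct trees: some vertex set that no edge
  crosses contains only one of them.\<close>

lemma same_tree_closed:
  assumes "same_tree E u v" "u \<in> S" "\<And>e. e \<in> E \<Longrightarrow> e \<inter> S = {} \<or> e \<subseteq> S"
  shows "v \<in> S"
  using assms(1) unfolding same_tree_def
proof (induction rule: rtrancl_induct)
  case base
  then show ?case using assms(2) .
next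
  case (step y z)
  then have "{y, z} \<in> E" by simp
  with assms(3)[of "{y, z}"] step.IH show ?case by auto
qed

definition edges_on :: "nat \<Rightarrow> edge set \<Rightarrow> bool" where
  "edges_on n E \<longleftrightarrow> (\<forall>e\<in>E. \<exists>u<n. \<exists>v<n. u \<noteq> v \<and> e = {u, v})"

text \<open>An inserted edge is not a loop because \<open>same_tree\<close> is reflexive, and
  deletions can only lower degrees.\<close>

lemma fully_dynamic_seqs_invariant:
  assumes "\<sigma> \<in> fully_dynamic_seqs n \<Delta>"
  shows "edges_on n (edges_after \<sigma>)" "\<And>w. w < n \<Longrightarrow> degree_at (edges_after \<sigma>) w \<le> \<Delta>"
  using assms
proof (induction \<sigma> rule: rev_induct)
  case Nil
  {
    case 1 show ?case by (simp add: edges_on_def)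
  next
    case 2 show ?case by (simp add: degree_at_def)
  }
next
  case (snoc u \<sigma>)
  {
    case 1
    then show ?case using snoc.IH(1)
    proof (cases u)
      case (Insert e)
      then obtain a b where "e = {a, b}" "a < n" "b < n" "\<not> same_tree (edges_after \<sigma>) a b"
        using 1 by auto
      moreover from this have "a \<noteq> b" by auto
      ultimately show ?thesis using snoc.IH(1) 1 Insert by (auto simp: edges_on_def)
    qed (auto simp: edges_on_def)
  next
    case (2 w)
    then have IH: "degree_at (edges_after \<sigma>) w \<le> \<Delta>"
      using snoc.IH by simp_all
    show ?case
    proof (cases u)
      case (Insert e)
      with 2 show ?thesis by simp
    next
      case (Delete e)
      have "card {f \<in> edges_after \<sigma> - {e}. w \<in> f} \<le> card {f \<in> edges_after \<sigma>. w \<in> f}"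
        by (intro card_mono) auto
      with Delete IH show ?thesis by (simp add: degree_at_def)
    qed
  }
qed

text \<open>Double counting of incidences: every edge has two endpoints and every vertex meets at
  most two edges.\<close>

lemma card_edges_le:
  assumes "edges_on n E" "finite E" "\<And>w. w < n \<Longrightarrow> degree_at E w \<le> 2"
  shows "card E \<le> n"
proof -
  have "2 * card E = (\<Sum>e\<in>E. card {w \<in> {..<n}. w \<in> e})"
  proof -
    have "card {w \<in> {..<n}. w \<in> e} = 2" if "e \<in> E" for e
    proof -
      from that assms(1) obtain u v where "u < n" "v < n" "u \<noteq> v" "e = {u, v}"
        by (auto simp: edges_on_def)
      then have "{w \<in> {..<n}. w \<in> e} = {u, v}" by auto
      with \<open>u \<noteq> v\<close> show ?thesis by simp
    qed
    then show ?thesis by simp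
  qed
  also have "\<dots> = (\<Sum>e\<in>E. \<Sum>w\<in>{w \<in> {..<n}. w \<in> e}. 1)"
    by simp
  also have "\<dots> = (\<Sum>w\<in>{..<n}. \<Sum>e\<in>{e \<in> E. w \<in> e}. 1)"
    by (rule sum.swap_restrict) (use assms in auto)
  also have "\<dots> = (\<Sum>w<n. degree_at E w)"
    by (simp add: degree_at_def)
  also have "\<dots> \<le> (\<Sum>w<n. 2)"
    by (rule sum_mono) (use assms in auto)
  finally show ?thesis by simp
qed

lemma card_edges_after_le:
  "\<sigma> \<in> fully_dynamic_seqs n 2 \<Longrightarrow> card (edges_after \<sigma>) \<le> n"
  using fully_dynamic_seqs_invariant by (blast intro: card_edges_le finite_edges_after)

section \<open>Upper bounds for the greedy algorithm\<close>

lemma recourse_le_card: "finite E \<Longrightarrow> recourse E u c c' \<le> card E"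
  unfolding recourse_def by (rule card_mono) auto

text \<open>An update recolors at most all present edges. Besides giving the fully dynamic upper
  bound, this makes the recourse of a randomized algorithm integrable.\<close>

lemma total_recourse_le:
  "\<sigma> \<in> fully_dynamic_seqs n 2 \<Longrightarrow> total_recourse \<sigma> c \<le> length \<sigma> * n"
proof (induction \<sigma> rule: rev_induct)
  case (snoc u \<sigma>)
  then have "recourse (edges_after \<sigma>) u (c (length \<sigma>)) (c (Suc (length \<sigma>))) \<le> n"
    using recourse_le_card card_edges_after_le
    by (metis finite_edges_after fully_dynamic_seqs_snoc le_trans)
  with snoc show ?case by simp
qed simp

section \<open>Edge sets of trees\<close>

definition component_edges :: "edge set \<Rightarrow> nat \<Rightarrow> edge set" where
  "component_edges E u = {f \<in> E. \<exists>y\<in>f. same_tree E u y}"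

text \<open>The tree is addressed by an edge here: recoloring costs refer to the tree of an endpoint
  of the new edge, the potential to the tree of each existing edge.\<close>

definition edge_component :: "edge set \<Rightarrow> edge \<Rightarrow> edge set" where
  "edge_component E f = {g \<in> E. \<exists>x\<in>f. \<exists>y\<in>g. same_tree E x y}"

lemma component_edges_all:
  assumes "edges_on n E" "f \<in> component_edges E u" "y \<in> f"
  shows "same_tree E u y"
proof -
  obtain z where z: "f \<in> E" "z \<in> f" "same_tree E u z"
    using assms by (auto simp: component_edges_def)
  with assms obtain a b where "f = {a, b}" by (auto simp: edges_on_def)
  then have "same_tree E z y"
    using z assms(3) same_tree_edge by (auto simp: insert_commute)
  with z show ?thesis by (blast intro: same_tree_trans)
qed

lemma component_edges_disjoint:
  assumes "edges_on n E" "\<not> same_tree E u v"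
  shows "component_edges E u \<inter> component_edges E v = {}"
proof (rule ccontr)
  assume "\<not> ?thesis"
  then obtain f y where "f \<in> component_edges E u" "f \<in> component_edges E v" "y \<in> f"
    by (auto simp: component_edges_def)
  then have "same_tree E u y" "same_tree E v y"
    using component_edges_all[OF assms(1)] by blast+
  with assms(2) show False by (blast intro: same_tree_trans same_tree_sym)
qed

lemma edge_component_eq:
  assumes "edges_on n E" "f \<in> component_edges E u"
  shows "edge_component E f = component_edges E u"
proof
  show "edge_component E f \<subseteq> component_edges E u"
    using component_edges_all[OF assms]
    by (auto simp: edge_component_def component_edges_def intro: same_tree_trans)
  obtain x where "x \<in> f" "same_tree E u x"
    using assms(2) by (auto simp: component_edges_def)
  then have "same_tree E x y" if "same_tree E u y" for y
    using that same_tree_sym same_tree_trans by blast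
  then show "component_edges E u \<subseteq> edge_component E f"
    using \<open>x \<in> f\<close> by (auto simp: edge_component_def component_edges_def)
qed

section \<open>Recoloring one of the two trees that an insertion joins\<close>

lemma degree_le_1_unique:
  assumes "finite E" "e \<notin> E" "v \<in> e" "degree_at (insert e E) v \<le> 2"
    and "f \<in> E" "g \<in> E" "v \<in> f" "v \<in> g"
  shows "f = g"
proof (rule ccontr)
  assume "f \<noteq> g"
  moreover have "e \<noteq> f" "e \<noteq> g" using assms by blast+
  ultimately have "card {e, f, g} = 3" by simp
  moreover have "card {e, f, g} \<le> degree_at (insert e E) v"
    unfolding degree_at_def using assms by (intro card_mono) auto
  ultimately show False using assms(4) by simp
qed

text \<open>Give the new edge a color \<open>d\<close> that is free at \<open>v\<close>. If the old
  edge at \<open>u\<close> has color \<open>d\<close> too, exchanging the two colors throughout the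
  tree of \<open>u\<close> removes the conflict and leaves the tree of \<open>v\<close>
  untouched.\<close>

lemma recoloring_one_side:
  assumes "finite E" "edges_on n E" "proper_coloring 2 E c"
    and "\<not> same_tree E u v"
    and "degree_at (insert {u, v} E) u \<le> 2" "degree_at (insert {u, v} E) v \<le> 2"
  obtains c' where "proper_coloring 2 (insert {u, v} E) c'"
    "recourse E (Insert {u, v}) c c' \<le> card (component_edges E u)"
proof -
  let ?e = "{u, v}"
  have e: "?e \<notin> E" using assms(4) same_tree_edge by blast
  have less: "c f < 2" if "f \<in> E" for f
    using assms(3) that by (auto simp: proper_coloring_def)
  have neq: "c f \<noteq> c g" if "f \<in> E" "g \<in> E" "f \<noteq> g" "f \<inter> g \<noteq> {}" for f g
    using assms(3) that by (auto simp: proper_coloring_def)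
  \<comment> \<open>The new edge uses up one of the two incidences allowed at each of its endpoints,
    so at most one old edge is left there.\<close>
  have uniq: "f = g" if "f \<in> E" "g \<in> E" "w \<in> f" "w \<in> g" "w \<in> ?e" for f g w
    using degree_le_1_unique[OF assms(1) e, of w f g] assms(5,6) that by auto
  have "\<exists>d<2. \<forall>g\<in>E. v \<in> g \<longrightarrow> c g \<noteq> d"
  proof (cases "\<exists>g\<in>E. v \<in> g")
    case True
    then obtain g where g: "g \<in> E" "v \<in> g" by blast
    show ?thesis
    proof (intro exI[of _ "1 - c g"] conjI ballI impI)
      show "c h \<noteq> 1 - c g" if "h \<in> E" "v \<in> h" for h
        using uniq[of h g v] that g less[of g] less_2_cases[of "c g"] by auto
    qed simp
  next
    case False
    then show ?thesis by (intro exI[of _ 0]) auto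
  qed
  then obtain d where d: "d < 2" "\<And>g. g \<in> E \<Longrightarrow> v \<in> g \<Longrightarrow> c g \<noteq> d"
    by blast
  \<comment> \<open>The flip is made exactly when an old edge at \<open>u\<close> has color
    \<open>d\<close>. Colors on \<open>E\<close> are below 2, so \<open>1 - c f\<close> is the other
    color.\<close>
  define fl where "fl \<longleftrightarrow> (\<exists>g\<in>E. u \<in> g \<and> c g = d)"
  define K where "K = component_edges E u"
  define c' where "c' f = (if f = ?e then d else if fl \<and> f \<in> K then 1 - c f else c f)" for f
  have c'E: "c' f = (if fl \<and> f \<in> K then 1 - c f else c f)" if "f \<in> E" for f
    using e that by (auto simp: c'_def)
  \<comment> \<open>Adjacent edges lie in the same tree, so they are flipped together or not at all
    and keep distinct colors.\<close>
  have K: "f \<in> K \<longleftrightarrow> g \<in> K" if "f \<in> E" "g \<in> E" "f \<inter> g \<noteq> {}" for f g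
    using that component_edges_all[OF assms(2)] unfolding K_def component_edges_def by blast
  have c'_neq: "c' f \<noteq> c' g" if "f \<in> E" "g \<in> E" "f \<noteq> g" "f \<inter> g \<noteq> {}" for f g
    using neq[OF that] K[of f g] that less[of f] less[of g] by (auto simp: c'E)
  have e_neq: "c' g \<noteq> d" if g: "g \<in> E" "g \<inter> ?e \<noteq> {}" for g
  proof (cases "u \<in> g")
    case True
    then have "g \<in> K" using g by (auto simp: K_def component_edges_def intro!: bexI[of _ u])
    moreover have "h = g" if "h \<in> E" "u \<in> h" for h
      using uniq[of h g u] True g that by simp
    then have "fl \<longleftrightarrow> c g = d"
      using True g unfolding fl_def by blast
    ultimately show ?thesis
      using g d(1) less[of g] less_2_cases[of "c g"] by (auto simp: c'E)
  next
    case False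
    then have "v \<in> g" using g by auto
    then have "g \<notin> K"
      using assms(4) component_edges_all[OF assms(2)] by (auto simp: K_def)
    then show ?thesis using d(2) g \<open>v \<in> g\<close> by (simp add: c'E)
  qed
  have "proper_coloring 2 (insert ?e E) c'"
    unfolding proper_coloring_def
  proof (intro conjI ballI impI)
    fix f assume "f \<in> insert ?e E"
    then show "c' f < 2" using d(1) less[of f] by (auto simp: c'_def)
  next
    fix f g assume *: "f \<in> insert ?e E" "g \<in> insert ?e E" "f \<noteq> g \<and> f \<inter> g \<noteq> {}"
    have [simp]: "c' ?e = d" by (simp add: c'_def)
    show "c' f \<noteq> c' g"
    proof (cases "f = ?e")
      case True
      with * e_neq[of g] show ?thesis by (auto simp: Int_commute)
    next
      case False
      then show ?thesis
        using * c'_neq[of f g] e_neq[of f] by (cases "g = ?e") auto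
    qed
  qed
  moreover have "recourse E (Insert ?e) c c' \<le> card K"
    unfolding recourse_def
  proof (rule card_mono)
    show "finite K" using assms(1) by (simp add: K_def component_edges_def)
    show "{f \<in> E \<inter> apply_update (Insert ?e) E. c f \<noteq> c' f} \<subseteq> K"
      by (auto simp: c'E split: if_splits)
  qed
  ultimately show ?thesis using that unfolding K_def by blast
qed

section \<open>The logarithmic potential and the incremental upper bound\<close>

definition potential :: "edge set \<Rightarrow> real" where
  "potential E = (\<Sum>f\<in>E. log 2 (real (card (edge_component E f))))"

lemma edge_component_self: "edges_on n E \<Longrightarrow> f \<in> E \<Longrightarrow> f \<in> edge_component E f"
  unfolding edges_on_def edge_component_def using same_tree_refl by fastforce

text \<open>An edge of the smaller tree at least doubles the size of its tree.\<close>

lemma potential_insert: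
  assumes "finite E" "edges_on n E" "edges_on n (insert {u, v} E)" "\<not> same_tree E u v"
    and "card (component_edges E u) \<le> card (component_edges E v)"
  shows "potential E + card (component_edges E u) \<le> potential (insert {u, v} E)"
proof -
  let ?e = "{u, v}" and ?A = "component_edges E u" and ?B = "component_edges E v"
  let ?E = "insert ?e E"
  have e: "?e \<notin> E" using assms(4) same_tree_edge by blast
  have fin: "finite (edge_component F f)" if "finite F" for F f
    using that by (simp add: edge_component_def)
  have AE: "?A \<subseteq> E" "?B \<subseteq> E" by (auto simp: component_edges_def)
  have finA: "finite ?A" "finite ?B" using AE assms(1) finite_subset by blast+
  have pos: "0 < card (edge_component F f)" if "finite F" "edges_on n F" "f \<in> F" for F f
    using edge_component_self[OF that(2,3)] fin[OF that(1)] card_gt_0_iff by blast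
  \<comment> \<open>The unit gained by each edge of the smaller tree pays for recoloring that
    edge.\<close>
  have step: "log 2 (card (edge_component E f)) + of_bool (f \<in> ?A)
      \<le> log 2 (card (edge_component ?E f))" if f: "f \<in> E" for f
  proof (cases "f \<in> ?A")
    case False
    have "edge_component E f \<subseteq> edge_component ?E f"
      unfolding edge_component_def using same_tree_mono[of E _ _ ?E] by blast
    then have "card (edge_component E f) \<le> card (edge_component ?E f)"
      using assms(1) fin by (intro card_mono) auto
    with False pos[OF assms(1,2) f] show ?thesis by simp
  next
    case True
    have E: "edge_component E f = ?A"
      using edge_component_eq[OF assms(2) True] .
    have uv: "same_tree ?E u v" by (rule same_tree_edge) simp
    have fA: "f \<in> component_edges ?E u"
      using True same_tree_mono[of E _ _ ?E] unfolding component_edges_def by blast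
    have "?A \<subseteq> component_edges ?E u"
      unfolding component_edges_def using same_tree_mono[of E _ _ ?E] by blast
    moreover have "?B \<subseteq> component_edges ?E u"
      unfolding component_edges_def
      using same_tree_mono[of E _ _ ?E] same_tree_trans[OF uv] by blast
    ultimately have "card (?A \<union> ?B) \<le> card (edge_component ?E f)"
      using assms(1) fin[of ?E f] edge_component_eq[OF assms(3) fA] by (intro card_mono) auto
    moreover have "card (?A \<union> ?B) = card ?A + card ?B"
      using finA component_edges_disjoint[OF assms(2,4)] by (rule card_Un_disjoint)
    ultimately have "2 * card ?A \<le> card (edge_component ?E f)"
      using assms(5) by simp
    moreover have "0 < card ?A" using pos[OF assms(1,2) f] E by simp
    ultimately have "log 2 (2 * card ?A) \<le> log 2 (card (edge_component ?E f))"
      by (subst log_le_cancel_iff) (auto simp flip: of_nat_mult)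
    then show ?thesis
      using True E \<open>0 < card ?A\<close> by (simp add: log_mult)
  qed
  have "potential E + card ?A
      = (\<Sum>f\<in>E. log 2 (card (edge_component E f)) + of_bool (f \<in> ?A))"
  proof -
    have "(\<Sum>f\<in>E. of_bool (f \<in> ?A)) = real (card ?A)"
      using assms(1) AE by (simp add: sum.If_cases of_bool_def Int_absorb1)
    then show ?thesis by (simp add: potential_def sum.distrib)
  qed
  also have "\<dots> \<le> (\<Sum>f\<in>E. log 2 (card (edge_component ?E f)))"
    by (rule sum_mono) (rule step)
  \<comment> \<open>The new edge contributes a nonnegative summand, since its component contains at
    least the edge itself.\<close>
  also have "\<dots> \<le> potential ?E"
    unfolding potential_def using assms(1) e pos[OF _ assms(3), of ?e] by simp
  finally show ?thesis .
qed

text \<open>A step costs at most the size of the smaller tree, and the increase of the potential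
  covers this. Properness is carried along because recoloring one tree starts from a proper
  coloring, the edge count because amortization divides by the length of the sequence.\<close>

lemma greedy_recourse_le:
  assumes "\<sigma> \<in> incremental_seqs n 2" "greedy_run 2 \<sigma> c"
  shows "proper_coloring 2 (edges_after \<sigma>) (c (length \<sigma>)) \<and> card (edges_after \<sigma>) = length \<sigma>
    \<and> real (total_recourse \<sigma> c) \<le> potential (edges_after \<sigma>)"
  using assms
proof (induction \<sigma> rule: rev_induct)
  case Nil
  then show ?case by (simp add: proper_coloring_def potential_def)
next
  case (snoc x \<sigma>)
  let ?E = "edges_after \<sigma>"
  have IH: "proper_coloring 2 ?E (c (length \<sigma>))" "card ?E = length \<sigma>"
    "real (total_recourse \<sigma> c) \<le> potential ?E"
    using snoc by auto
  from snoc.prems obtain u v where x: "x = Insert {u, v}" and uv: "u < n" "v < n"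
    "\<not> same_tree ?E u v" and deg: "\<And>w. w < n \<Longrightarrow> degree_at (insert {u, v} ?E) w \<le> 2"
    by auto
  have dyn: "\<sigma> \<in> fully_dynamic_seqs n 2" "\<sigma> @ [x] \<in> fully_dynamic_seqs n 2"
    using snoc.prems by (auto simp: incremental_seqs_def)
  have fin: "finite ?E" and on: "edges_on n ?E" "edges_on n (insert {u, v} ?E)"
    using fully_dynamic_seqs_invariant(1)[OF dyn(1)] fully_dynamic_seqs_invariant(1)[OF dyn(2)] x
    by auto
  have greedy: "is_arg_min (recourse ?E x (c (length \<sigma>)))
      (proper_coloring 2 (insert {u, v} ?E)) (c (Suc (length \<sigma>)))"
    using snoc.prems x by simp
  \<comment> \<open>Stated for either order of the endpoints, so that the smaller tree may be on
    either side.\<close>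
  have "potential ?E + recourse ?E x (c (length \<sigma>)) (c (Suc (length \<sigma>)))
      \<le> potential (insert {u, v} ?E)"
    if sep: "\<not> same_tree ?E u' v'" and uv': "{u', v'} = {u, v}"
      and le: "card (component_edges ?E u') \<le> card (component_edges ?E v')" for u' v'
  proof -
    have "u' < n" "v' < n" using uv uv' by (auto simp: doubleton_eq_iff)
    obtain c' where c': "proper_coloring 2 (insert {u, v} ?E) c'"
      "recourse ?E x (c (length \<sigma>)) c' \<le> card (component_edges ?E u')"
      using recoloring_one_side[OF fin on(1) IH(1) sep] deg \<open>u' < n\<close> \<open>v' < n\<close> x uv'
      by metis
    \<comment> \<open>Greedy minimizes the recourse over all proper colorings, so it costs no more
      than flipping the tree of \<open>u'\<close>.\<close>
    with greedy have "recourse ?E x (c (length \<sigma>)) (c (Suc (length \<sigma>)))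
        \<le> card (component_edges ?E u')"
      unfolding is_arg_min_def by (meson le_trans not_le)
    with potential_insert[OF fin on(1) _ sep le] uv' on(2) show ?thesis by simp
  qed
  from this[of u v] this[of v u] have
    "potential ?E + recourse ?E x (c (length \<sigma>)) (c (Suc (length \<sigma>)))
      \<le> potential (insert {u, v} ?E)"
    using uv(3) same_tree_sym[of ?E v u] insert_commute[of v u "{}"] by (meson nat_le_linear)
  moreover have "{u, v} \<notin> ?E" using uv(3) same_tree_edge by blast
  ultimately show ?case
    using IH greedy fin x by (auto simp: is_arg_min_def)
qed

lemma potential_le:
  assumes "finite E" "edges_on n E" "card E \<le> n"
  shows "potential E \<le> card E * log 2 n"
proof -
  have "log 2 (card (edge_component E f)) \<le> log 2 n" if f: "f \<in> E" for f
  proof -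
    have "card (edge_component E f) \<le> card E"
      using assms(1) by (intro card_mono) (auto simp: edge_component_def)
    moreover have "edge_component E f \<noteq> {}" "finite (edge_component E f)"
      using edge_component_self[OF assms(2) f] assms(1) by (auto simp: edge_component_def)
    then have "0 < card (edge_component E f)" by (simp add: card_gt_0_iff)
    ultimately show ?thesis using assms(3) by simp
  qed
  then have "potential E \<le> (\<Sum>f\<in>E. log 2 n)"
    unfolding potential_def by (rule sum_mono)
  then show ?thesis by simp
qed

lemma greedy_amortized_le:
  assumes "n \<ge> 2" "\<sigma> \<in> incremental_seqs n 2" "greedy_run 2 \<sigma> c"
  shows "amortized_recourse \<sigma> c \<le> 1 / ln 2 * ln (real n)"
proof -
  have dyn: "\<sigma> \<in> fully_dynamic_seqs n 2" using assms by (simp add: incremental_seqs_def)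
  have "real (total_recourse \<sigma> c) \<le> length \<sigma> * log 2 n"
    using greedy_recourse_le[OF assms(2,3)] card_edges_after_le[OF dyn]
      potential_le[OF finite_edges_after fully_dynamic_seqs_invariant(1)[OF dyn]] by auto
  \<comment> \<open>Covers the empty sequence, whose amortized recourse \<open>0 / 0\<close> is
    0.\<close>
  moreover have "0 \<le> log 2 n" using assms(1) by simp
  ultimately show ?thesis
    by (cases "\<sigma> = []") (auto simp: amortized_recourse_def log_def field_simps)
qed

lemma amortized_recourse_le:
  assumes "\<sigma> \<in> fully_dynamic_seqs n 2"
  shows "amortized_recourse \<sigma> c \<le> real n"
proof (cases "\<sigma> = []")
  case False
  have "real (total_recourse \<sigma> c) \<le> real (length \<sigma>) * real n"
    using total_recourse_le[OF assms, of c] by (metis of_nat_le_iff of_nat_mult)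
  with False show ?thesis by (simp add: amortized_recourse_def field_simps)
qed (simp add: amortized_recourse_def)

section \<open>Paths\<close>

definition path_edges :: "nat list \<Rightarrow> edge set" where
  "path_edges P = (\<lambda>i. {P ! i, P ! Suc i}) ` {i. Suc i < length P}"

lemma path_edges_singleton [simp]: "path_edges [v] = {}"
  by (simp add: path_edges_def)

lemma path_edgesI: "Suc i < length P \<Longrightarrow> {P ! i, P ! Suc i} \<in> path_edges P"
  by (auto simp: path_edges_def)

lemma path_edges_subset: "e \<in> path_edges P \<Longrightarrow> e \<subseteq> set P"
  by (auto simp: path_edges_def)

lemma path_edges_memD: "e \<in> path_edges P \<Longrightarrow> v \<in> e \<Longrightarrow> v \<in> set P"
  using path_edges_subset by blast

lemma finite_path_edges [simp]: "finite (path_edges P)"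
proof -
  have "finite {i. Suc i < length P}"
    by (rule finite_subset[of _ "{..<length P}"]) auto
  then show ?thesis by (simp add: path_edges_def)
qed

lemma path_edges_append:
  assumes "P \<noteq> []" "Q \<noteq> []"
  shows "path_edges (P @ Q) = insert {last P, hd Q} (path_edges P \<union> path_edges Q)"
proof
  show "path_edges (P @ Q) \<subseteq> insert {last P, hd Q} (path_edges P \<union> path_edges Q)"
  proof
    fix e assume "e \<in> path_edges (P @ Q)"
    then obtain i where i: "Suc i < length P + length Q" "e = {(P @ Q) ! i, (P @ Q) ! Suc i}"
      by (auto simp: path_edges_def)
    consider "Suc i < length P" | "Suc i = length P" | "length P \<le> i" by linarith
    then show "e \<in> insert {last P, hd Q} (path_edges P \<union> path_edges Q)"
    proof cases
      case 1
      then show ?thesis using i path_edgesI[of i P] by (simp add: nth_append)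
    next
      case 2
      then have "i = length P - 1" by simp
      with 2 i assms show ?thesis
        by (simp add: nth_append last_conv_nth hd_conv_nth)
    next
      case 3
      then show ?thesis
        using i path_edgesI[of "i - length P" Q] by (simp add: nth_append Suc_diff_le)
    qed
  qed
  have "path_edges P \<subseteq> path_edges (P @ Q)"
  proof
    fix e assume "e \<in> path_edges P"
    then obtain i where "Suc i < length P" "e = {P ! i, P ! Suc i}"
      by (auto simp: path_edges_def)
    then show "e \<in> path_edges (P @ Q)"
      using path_edgesI[of i "P @ Q"] by (simp add: nth_append)
  qed
  moreover have "path_edges Q \<subseteq> path_edges (P @ Q)"
  proof
    fix e assume "e \<in> path_edges Q"
    then obtain i where "Suc i < length Q" "e = {Q ! i, Q ! Suc i}"
      by (auto simp: path_edges_def)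
    then show "e \<in> path_edges (P @ Q)"
      using path_edgesI[of "length P + i" "P @ Q"] by (simp add: nth_append)
  qed
  moreover have "{last P, hd Q} \<in> path_edges (P @ Q)"
    using assms path_edgesI[of "length P - 1" "P @ Q"]
    by (simp add: nth_append last_conv_nth hd_conv_nth)
  ultimately show "insert {last P, hd Q} (path_edges P \<union> path_edges Q) \<subseteq> path_edges (P @ Q)"
    by simp
qed

lemma card_path_edges:
  assumes "distinct P"
  shows "card (path_edges P) = length P - 1"
proof -
  have "inj_on (\<lambda>i. {P ! i, P ! Suc i}) {i. Suc i < length P}"
    using assms by (intro inj_onI) (auto simp: doubleton_eq_iff nth_eq_iff_index_eq)
  moreover have "{i. Suc i < length P} = {..<length P - 1}" by auto
  ultimately show ?thesis by (simp add: path_edges_def card_image)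
qed

section \<open>Degrees along paths and validity of insertions\<close>

lemma degree_path_edges:
  assumes "distinct P"
  shows "degree_at (path_edges P) w \<le> 2"
proof (cases "w \<in> set P")
  case True
  then obtain j where j: "j < length P" "w = P ! j" by (auto simp: in_set_conv_nth)
  \<comment> \<open>At the first vertex \<open>j - 1\<close> is 0, and at the last one
    \<open>Suc j\<close> is out of range; the extra sets are harmless, as only an inclusion is
    claimed.\<close>
  have "{e \<in> path_edges P. w \<in> e} \<subseteq> {{P ! (j - 1), P ! j}, {P ! j, P ! Suc j}}"
    using assms j by (auto simp: path_edges_def nth_eq_iff_index_eq)
  then have "card {e \<in> path_edges P. w \<in> e} \<le> card {{P ! (j - 1), P ! j}, {P ! j, P ! Suc j}}"
    by (intro card_mono) auto
  also have "\<dots> \<le> 2" by (simp add: card_insert_if)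
  finally show ?thesis by (simp add: degree_at_def)
next
  case False
  then have "{e \<in> path_edges P. w \<in> e} = {}" using path_edges_subset by blast
  then show ?thesis by (simp only: degree_at_def card.empty)
qed

text \<open>No vertex meets both an edge of \<open>E\<close> and an edge of the path, so the two
  degree bounds do not add up.\<close>

lemma degree_disjoint_path:
  assumes "finite E" "\<And>e. e \<in> E \<Longrightarrow> e \<inter> set R = {}" "degree_at E w \<le> 2" "distinct R"
    and "F \<subseteq> E \<union> path_edges R"
  shows "degree_at F w \<le> 2"
proof (cases "w \<in> set R")
  case True
  then have "{e \<in> F. w \<in> e} \<subseteq> {e \<in> path_edges R. w \<in> e}"
    using assms by blast
  then have "degree_at F w \<le> degree_at (path_edges R) w"
    unfolding degree_at_def by (intro card_mono) auto
  with degree_path_edges[OF assms(4), of w] show ?thesis by linarith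
next
  case False
  then have "{e \<in> F. w \<in> e} \<subseteq> {e \<in> E. w \<in> e}"
    using assms path_edges_subset by blast
  then have "degree_at F w \<le> degree_at E w"
    unfolding degree_at_def using assms(1) by (intro card_mono) auto
  with assms(3) show ?thesis by linarith
qed

text \<open>Common form of the insertions below: \<open>S\<close> is crossed by no edge and
  separates \<open>u\<close> from \<open>v\<close>, and the enlarged graph fits into a graph
  \<open>E0\<close> of degree at most 2 together with a path \<open>R\<close> disjoint from
  it.\<close>

lemma valid_insert:
  assumes "u < n" "v < n" "u \<in> S" "v \<notin> S" "\<And>e. e \<in> E \<Longrightarrow> e \<inter> S = {} \<or> e \<subseteq> S"
    and "finite E0" "\<And>e. e \<in> E0 \<Longrightarrow> e \<inter> set R = {}" "\<And>w. w < n \<Longrightarrow> degree_at E0 w \<le> 2"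
    and "distinct R" "insert {u, v} E \<subseteq> E0 \<union> path_edges R"
  shows "valid_update n 2 E (Insert {u, v})"
proof -
  have "\<not> same_tree E u v"
    using same_tree_closed[of E u v S] assms(3-5) by blast
  moreover have "degree_at (insert {u, v} E) w \<le> 2" if "w < n" for w
    using degree_disjoint_path[OF assms(6,7) assms(8)[OF that] assms(9,10)] .
  ultimately show ?thesis using assms(1,2) by auto
qed

section \<open>Alternating colorings of paths\<close>

definition phase :: "coloring \<Rightarrow> nat list \<Rightarrow> nat \<Rightarrow> bool" where
  "phase c P b \<longleftrightarrow> (\<forall>i. Suc i < length P \<longrightarrow> c {P ! i, P ! Suc i} = (b + i) mod 2)"

text \<open>Consecutive edges of the path are distinct because its vertices are, so the two colors
  alternate. Only the parity of the phase matters; it is left unreduced so that it can be shifted by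
  path lengths.\<close>

lemma proper_coloring_phase:
  assumes "proper_coloring 2 E c" "path_edges P \<subseteq> E" "distinct P"
  shows "\<exists>b. phase c P b"
proof -
  have less: "c {P ! i, P ! Suc i} < 2" if "Suc i < length P" for i
    using assms(1,2) path_edgesI[OF that] by (auto simp: proper_coloring_def)
  have "c {P ! i, P ! Suc i} = (c {P ! 0, P ! 1} + i) mod 2" if "Suc i < length P" for i
    using that
  proof (induction i)
    case 0
    then show ?case using less[of 0] by simp
  next
    case (Suc i)
    let ?e = "{P ! i, P ! Suc i}" and ?f = "{P ! Suc i, P ! Suc (Suc i)}"
    have "P ! i \<noteq> P ! Suc (Suc i)" using Suc.prems assms(3) by (simp add: nth_eq_iff_index_eq)
    then have "?e \<noteq> ?f" by (auto simp: doubleton_eq_iff)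
    moreover have "?e \<in> E" "?f \<in> E"
      using Suc.prems assms(2) path_edgesI[of i P] path_edgesI[of "Suc i" P] by auto
    ultimately have "c ?e \<noteq> c ?f"
      using assms(1) unfolding proper_coloring_def by (metis disjoint_iff insertCI)
    moreover have "c ?e = (c {P ! 0, P ! 1} + i) mod 2" using Suc by simp
    ultimately show ?case using less[of "Suc i"] less[of i] Suc.prems
      by (simp add: mod2_eq_if split: if_splits)
  qed
  then show ?thesis unfolding phase_def by blast
qed

lemma phase_append_left: "phase c (P @ Q) b \<Longrightarrow> phase c P b"
  unfolding phase_def by (metis Suc_lessD length_append nth_append trans_less_add1)

lemma phase_append_right:
  assumes "phase c (P @ Q) b"
  shows "phase c Q (b + length P)"
  unfolding phase_def
proof (intro allI impI)
  fix i assume "Suc i < length Q"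
  then show "c {Q ! i, Q ! Suc i} = (b + length P + i) mod 2"
    using assms[unfolded phase_def, rule_format, of "length P + i"]
    by (simp add: nth_append add.assoc)
qed

lemma phase_neq:
  assumes "phase c P b" "phase c' P b'" "odd (b + b')" "e \<in> path_edges P"
  shows "c e \<noteq> c' e"
proof -
  obtain i where i: "Suc i < length P" "e = {P ! i, P ! Suc i}"
    using assms(4) by (auto simp: path_edges_def)
  then have "c e = (b + i) mod 2" "c' e = (b' + i) mod 2"
    using assms(1,2) by (simp_all add: phase_def)
  then show ?thesis using assms(3) by presburger
qed

text \<open>The parity of \<open>b + d\<close> is the color of one path relative to the other. When
  it changes, exactly one of the two paths changes the parity of its phase, and then every edge of
  that path changes color.\<close>

lemma card_recolored_ge:
  assumes "distinct P" "distinct Q" "phase c P b" "phase c Q d" "phase c' P b'" "phase c' Q d'"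
    and "odd (b + d + b' + d')"
  shows "min (length P - 1) (length Q - 1) \<le> card {f \<in> path_edges P \<union> path_edges Q. c f \<noteq> c' f}"
    (is "_ \<le> card ?D")
proof (cases "even (b + b')")
  case False
  then have "path_edges P \<subseteq> ?D"
    using phase_neq[OF assms(3,5)] by auto
  then have "card (path_edges P) \<le> card ?D" by (intro card_mono) auto
  then show ?thesis using card_path_edges[OF assms(1)] by linarith
next
  case True
  then have "path_edges Q \<subseteq> ?D"
    using phase_neq[OF assms(4,6)] assms(7) by auto
  then have "card (path_edges Q) \<le> card ?D" by (intro card_mono) auto
  then show ?thesis using card_path_edges[OF assms(2)] by linarith
qed

section \<open>Recourse of online algorithms\<close>

definition algorithm_recourse :: "algorithm \<Rightarrow> update list \<Rightarrow> nat" where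
  "algorithm_recourse A \<sigma> = total_recourse \<sigma> (\<lambda>i. A (take i \<sigma>))"

lemma algorithm_recourse_Nil [simp]: "algorithm_recourse A [] = 0"
  by (simp add: algorithm_recourse_def)

lemma algorithm_recourse_snoc:
  "algorithm_recourse A (\<sigma> @ [u])
     = algorithm_recourse A \<sigma> + recourse (edges_after \<sigma>) u (A \<sigma>) (A (\<sigma> @ [u]))"
proof -
  have "total_recourse \<sigma> (\<lambda>i. A (take i (\<sigma> @ [u]))) = total_recourse \<sigma> (\<lambda>i. A (take i \<sigma>))"
    unfolding total_recourse_def by (rule sum.cong) (auto simp: Suc_leI)
  then show ?thesis by (simp add: algorithm_recourse_def)
qed

text \<open>A triangle inequality: an edge whose colors before and after \<open>\<tau>\<close>
  differ was recolored by some update in between, and its presence throughout makes that change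
  count.\<close>

lemma algorithm_recourse_append_ge:
  assumes "finite S" "\<And>i. i \<le> length \<tau> \<Longrightarrow> S \<subseteq> edges_after (\<sigma> @ take i \<tau>)"
  shows "algorithm_recourse A \<sigma> + card {f \<in> S. A \<sigma> f \<noteq> A (\<sigma> @ \<tau>) f}
    \<le> algorithm_recourse A (\<sigma> @ \<tau>)"
  using assms(2)
proof (induction \<tau> rule: rev_induct)
  case Nil
  then show ?case by simp
next
  case (snoc u \<tau>)
  let ?\<sigma> = "\<sigma> @ \<tau>"
  have "S \<subseteq> edges_after (\<sigma> @ take i \<tau>)" if "i \<le> length \<tau>" for i
    using snoc.prems[of i] that by simp
  then have IH: "algorithm_recourse A \<sigma> + card {f \<in> S. A \<sigma> f \<noteq> A ?\<sigma> f}
      \<le> algorithm_recourse A ?\<sigma>"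
    by (rule snoc.IH)
  let ?E = "{f \<in> S. A ?\<sigma> f \<noteq> A (?\<sigma> @ [u]) f}"
  have S: "S \<subseteq> edges_after ?\<sigma>" "S \<subseteq> apply_update u (edges_after ?\<sigma>)"
    using snoc.prems[of "length \<tau>"] snoc.prems[of "Suc (length \<tau>)"]
    by (simp_all flip: append_assoc)
  have "card {f \<in> S. A \<sigma> f \<noteq> A (?\<sigma> @ [u]) f}
      \<le> card ({f \<in> S. A \<sigma> f \<noteq> A ?\<sigma> f} \<union> ?E)"
    using assms(1) by (intro card_mono) auto
  also have "\<dots> \<le> card {f \<in> S. A \<sigma> f \<noteq> A ?\<sigma> f} + card ?E"
    by (rule card_Un_le)
  finally have 1: "card {f \<in> S. A \<sigma> f \<noteq> A (?\<sigma> @ [u]) f}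
      \<le> card {f \<in> S. A \<sigma> f \<noteq> A ?\<sigma> f} + card ?E" .
  have "card ?E \<le> recourse (edges_after ?\<sigma>) u (A ?\<sigma>) (A (?\<sigma> @ [u]))"
    unfolding recourse_def using S by (intro card_mono) auto
  with 1 IH algorithm_recourse_snoc[of A ?\<sigma> u] show ?case by simp
qed

section \<open>Expected recourse: measurability and integrability\<close>

definition expected_recourse :: "algorithm measure \<Rightarrow> update list \<Rightarrow> real" where
  "expected_recourse M \<sigma> = (\<integral>A. real (algorithm_recourse A \<sigma>) \<partial>M)"

lemma expected_amortized_recourse_eq:
  "expected_amortized_recourse M \<sigma> = expected_recourse M \<sigma> / real (length \<sigma>)"
  unfolding expected_amortized_recourse_def expected_recourse_def amortized_recourse_def
    algorithm_recourse_def by simp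

text \<open>The recourse is a finite sum of indicators of color changes of single edges.
  Measurability of colors is given on \<open>S\<close> only, so prefixes have to stay in
  \<open>S\<close>.\<close>

lemma algorithm_recourse_measurable:
  assumes M: "randomized_algorithm k S M" and S: "\<And>\<sigma> u. \<sigma> @ [u] \<in> S \<Longrightarrow> \<sigma> \<in> S"
    and "S \<subseteq> fully_dynamic_seqs n \<Delta>" "\<sigma> \<in> S"
  shows "(\<lambda>A. real (algorithm_recourse A \<sigma>)) \<in> borel_measurable M"
  using assms(4)
proof (induction \<sigma> rule: rev_induct)
  case (snoc u \<sigma>)
  let ?E = "edges_after \<sigma> \<inter> apply_update u (edges_after \<sigma>)"
  have fin: "finite ?E" by simp
  have meas [measurable]: "(\<lambda>A. A \<sigma> f) \<in> measurable M (count_space UNIV)"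
    "(\<lambda>A. A (\<sigma> @ [u]) f) \<in> measurable M (count_space UNIV)" if "f \<in> ?E" for f
    using M S[OF snoc.prems] snoc.prems that unfolding randomized_algorithm_def by force+
  have "real (recourse (edges_after \<sigma>) u (A \<sigma>) (A (\<sigma> @ [u])))
      = (\<Sum>f\<in>?E. if A \<sigma> f = A (\<sigma> @ [u]) f then 0 else 1)" for A
    using fin by (simp add: recourse_def sum.If_cases Collect_neg_eq Int_def Diff_eq)
  moreover have "(\<lambda>A. \<Sum>f\<in>?E. if A \<sigma> f = A (\<sigma> @ [u]) f then 0 else (1::real)) \<in> borel_measurable M"
  proof (rule borel_measurable_sum)
    fix f assume f: "f \<in> ?E"
    note [measurable] = meas[OF f]
    show "(\<lambda>A. if A \<sigma> f = A (\<sigma> @ [u]) f then 0 else (1::real)) \<in> borel_measurable M"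
      by measurable
  qed
  ultimately show ?case
    using snoc.IH[OF S[OF snoc.prems]] by (simp add: algorithm_recourse_snoc)
qed simp

lemma algorithm_recourse_integrable:
  assumes "randomized_algorithm k S M" "\<And>\<sigma> u. \<sigma> @ [u] \<in> S \<Longrightarrow> \<sigma> \<in> S"
    and "S \<subseteq> fully_dynamic_seqs n 2" "\<sigma> \<in> S"
  shows "integrable M (\<lambda>A. real (algorithm_recourse A \<sigma>))"
proof -
  interpret prob_space M using assms(1) by (simp add: randomized_algorithm_def)
  have "norm (real (algorithm_recourse A \<sigma>)) \<le> real (length \<sigma> * n)" for A
    unfolding algorithm_recourse_def
    using total_recourse_le[of \<sigma> n "\<lambda>i. A (take i \<sigma>)"] assms(3,4)
    by (auto simp del: of_nat_mult)
  then show ?thesis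
    by (intro integrable_const_bound algorithm_recourse_measurable[OF assms] AE_I2)
qed

section \<open>Lower bound in the incremental model\<close>

text \<open>\<open>s0\<close> places \<open>x\<close> between the paths and \<open>s1\<close> behind
  them, so the two variants prescribe opposite relative colors of \<open>P\<close> and
  \<open>Q\<close>. Whatever the coloring before, one of them forces a whole path to be recolored.
  Which one depends on \<open>A\<close>, but the sum of both costs does not refer to this, so the
  inequality can be integrated over a random \<open>A\<close>.\<close>

lemma merge_paths:
  fixes P Q x
  defines "s0 \<equiv> [Insert {x, last P}, Insert {hd Q, x}]"
    and "s1 \<equiv> [Insert {last P, hd Q}, Insert {x, last Q}]"
  assumes \<sigma>: "\<sigma> \<in> incremental_seqs n 2" and E: "edges_after \<sigma> = E \<union> path_edges P \<union> path_edges Q"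
    and E0: "finite E" "\<And>w. w < n \<Longrightarrow> degree_at E w \<le> 2"
      "\<And>e. e \<in> E \<Longrightarrow> e \<inter> set (P @ Q @ [x]) = {}"
    and ne: "P \<noteq> []" "Q \<noteq> []" and dist: "distinct (P @ Q @ [x])"
    and less: "set (P @ Q @ [x]) \<subseteq> {..<n}"
  shows "\<sigma> @ s0 \<in> incremental_seqs n 2" "\<sigma> @ s1 \<in> incremental_seqs n 2"
    and "edges_after (\<sigma> @ s0) = E \<union> path_edges (P @ [x] @ Q)"
    and "edges_after (\<sigma> @ s1) = E \<union> path_edges (P @ Q @ [x])"
    and "\<lbrakk>odd (length P); odd (length Q);
        \<And>\<rho>. \<rho> \<in> incremental_seqs n 2 \<Longrightarrow> proper_coloring 2 (edges_after \<rho>) (A \<rho>)\<rbrakk>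
      \<Longrightarrow> 2 * algorithm_recourse A \<sigma> + min (length P - 1) (length Q - 1)
        \<le> algorithm_recourse A (\<sigma> @ s0) + algorithm_recourse A (\<sigma> @ s1)"
proof -
  have ends: "last P \<in> set P" "last Q \<in> set Q" "hd Q \<in> set Q"
    using ne by auto
  have path0: "path_edges (P @ [x] @ Q)
      = {{x, last P}, {hd Q, x}} \<union> path_edges P \<union> path_edges Q"
    using ne by (auto simp: path_edges_append[of P "[x] @ Q"] path_edges_append[of "[x]" Q]
        insert_commute simp del: append_Cons)
  have path1: "path_edges (P @ Q @ [x])
      = {{last P, hd Q}, {x, last Q}} \<union> path_edges P \<union> path_edges Q"
    using ne by (auto simp: path_edges_append[of P "Q @ [x]"] path_edges_append[of Q "[x]"]
        insert_commute)
  note path0' = path0[unfolded append_Cons append_Nil]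
  have dist0: "distinct (P @ [x] @ Q)" and E00: "\<And>e. e \<in> E \<Longrightarrow> e \<inter> set (P @ [x] @ Q) = {}"
    using dist E0(3) by auto
  \<comment> \<open>In all four insertions \<open>S\<close> is a whole tree of the current graph:
    the isolated vertex \<open>x\<close>, or a path not yet connected to anything else.\<close>
  have v1: "valid_update n 2 (edges_after \<sigma>) (Insert {x, last P})"
    by (rule valid_insert[where S = "{x}", OF _ _ _ _ _ E0(1) E00 E0(2) dist0])
      (use ends less dist E0(3) in \<open>auto simp: E path0' dest: path_edges_memD\<close>)
  have v2: "valid_update n 2 (insert {x, last P} (edges_after \<sigma>)) (Insert {hd Q, x})"
    by (rule valid_insert[where S = "set Q", OF _ _ _ _ _ E0(1) E00 E0(2) dist0])
      (use ends less dist E0(3) in \<open>auto simp: E path0' dest: path_edges_memD\<close>)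
  have v3: "valid_update n 2 (edges_after \<sigma>) (Insert {last P, hd Q})"
    by (rule valid_insert[where S = "set P", OF _ _ _ _ _ E0(1,3,2) dist])
      (use ends less dist E0(3) in \<open>auto simp: E path1 dest: path_edges_memD\<close>)
  have v4: "valid_update n 2 (insert {last P, hd Q} (edges_after \<sigma>)) (Insert {x, last Q})"
    by (rule valid_insert[where S = "{x}", OF _ _ _ _ _ E0(1,3,2) dist])
      (use ends less dist E0(3) in \<open>auto simp: E path1 dest: path_edges_memD\<close>)
  have split: "\<sigma> @ [u, v] = (\<sigma> @ [u]) @ [v]" for u v :: update by simp
  show mem: "\<sigma> @ s0 \<in> incremental_seqs n 2" "\<sigma> @ s1 \<in> incremental_seqs n 2"
    unfolding s0_def s1_def split incremental_seqs_snoc using \<sigma> v1 v2 v3 v4 by auto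
  show E': "edges_after (\<sigma> @ s0) = E \<union> path_edges (P @ [x] @ Q)"
    "edges_after (\<sigma> @ s1) = E \<union> path_edges (P @ Q @ [x])"
    unfolding s0_def s1_def split edges_after_snoc path0 path1 by (auto simp: E)
  assume odd: "odd (length P)" "odd (length Q)"
    and proper: "\<And>\<rho>. \<rho> \<in> incremental_seqs n 2 \<Longrightarrow> proper_coloring 2 (edges_after \<rho>) (A \<rho>)"
  let ?m = "min (length P - 1) (length Q - 1)"
  have distPQ: "distinct P" "distinct Q" using dist by auto
  obtain b d where bd: "phase (A \<sigma>) P b" "phase (A \<sigma>) Q d"
    using proper_coloring_phase[OF proper[OF \<sigma>]] E distPQ by (metis Un_upper1 Un_upper2 le_supI1)
  have ge: "algorithm_recourse A \<sigma> + card {f \<in> path_edges P \<union> path_edges Q. A \<sigma> f \<noteq> A (\<sigma> @ [u, v]) f}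
      \<le> algorithm_recourse A (\<sigma> @ [u, v])"
    if "u \<in> range Insert" "v \<in> range Insert" for u v
  proof (rule algorithm_recourse_append_ge)
    fix i
    have "edges_after (\<sigma> @ take i [u, v]) \<supseteq> edges_after \<sigma>"
      using that by (auto simp: take_Cons' edges_after_def)
    then show "path_edges P \<union> path_edges Q \<subseteq> edges_after (\<sigma> @ take i [u, v])"
      using E by blast
  qed simp
  have mono: "algorithm_recourse A \<sigma> \<le> algorithm_recourse A (\<sigma> @ s0)"
    "algorithm_recourse A \<sigma> \<le> algorithm_recourse A (\<sigma> @ s1)"
    using ge unfolding s0_def s1_def by (meson add_leD1 rangeI)+
  obtain b0 where b0: "phase (A (\<sigma> @ s0)) (P @ [x] @ Q) b0"
    using proper_coloring_phase[OF proper[OF mem(1)] _ dist0] E'(1) by blast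
  obtain b1 where b1: "phase (A (\<sigma> @ s1)) (P @ Q @ [x]) b1"
    using proper_coloring_phase[OF proper[OF mem(2)] _ dist] E'(2) by blast
  \<comment> \<open>With \<open>length P\<close> odd, the phases of \<open>P\<close> and
    \<open>Q\<close> have equal parity after \<open>s0\<close> and opposite parity after
    \<open>s1\<close>.\<close>
  have ph0: "phase (A (\<sigma> @ s0)) P b0" "phase (A (\<sigma> @ s0)) Q (b0 + length P + 1)"
    using phase_append_left[OF b0] phase_append_right[OF phase_append_right[OF b0]] by simp_all
  have ph1: "phase (A (\<sigma> @ s1)) P b1" "phase (A (\<sigma> @ s1)) Q (b1 + length P)"
    using phase_append_left[OF b1] phase_append_left[OF phase_append_right[OF b1]] by simp_all
  show "2 * algorithm_recourse A \<sigma> + ?m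
      \<le> algorithm_recourse A (\<sigma> @ s0) + algorithm_recourse A (\<sigma> @ s1)"
  proof (cases "even (b + d)")
    case True
    then have "?m \<le> card {f \<in> path_edges P \<union> path_edges Q. A \<sigma> f \<noteq> A (\<sigma> @ s1) f}"
      using odd by (intro card_recolored_ge[OF distPQ bd ph1]) auto
    moreover have "algorithm_recourse A \<sigma>
        + card {f \<in> path_edges P \<union> path_edges Q. A \<sigma> f \<noteq> A (\<sigma> @ s1) f}
        \<le> algorithm_recourse A (\<sigma> @ s1)"
      unfolding s1_def by (rule ge) auto
    ultimately show ?thesis using mono(1) by linarith
  next
    case False
    then have "?m \<le> card {f \<in> path_edges P \<union> path_edges Q. A \<sigma> f \<noteq> A (\<sigma> @ s0) f}"
      using odd by (intro card_recolored_ge[OF distPQ bd ph0]) auto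
    moreover have "algorithm_recourse A \<sigma>
        + card {f \<in> path_edges P \<union> path_edges Q. A \<sigma> f \<noteq> A (\<sigma> @ s0) f}
        \<le> algorithm_recourse A (\<sigma> @ s0)"
      unfolding s0_def by (rule ge) auto
    ultimately show ?thesis using mono(2) by linarith
  qed
qed

text \<open>Instead of drawing the merges at random and applying Yao's principle, each merge is fixed
  to the variant with the larger conditional expectation.\<close>

lemma incremental_block:
  assumes M: "randomized_algorithm 2 (incremental_seqs n 2) M"
    and "\<sigma> \<in> incremental_seqs n 2" "a + (2 ^ Suc k - 1) \<le> n"
    and "\<And>e. e \<in> edges_after \<sigma> \<Longrightarrow> e \<inter> {a..<a + (2 ^ Suc k - 1)} = {}"
  shows "\<exists>\<tau> P. \<sigma> @ \<tau> \<in> incremental_seqs n 2 \<and> length \<tau> = 2 ^ Suc k - 2 \<and> distinct P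
    \<and> set P = {a..<a + (2 ^ Suc k - 1)} \<and> edges_after (\<sigma> @ \<tau>) = edges_after \<sigma> \<union> path_edges P
    \<and> expected_recourse M \<sigma> + (real k * 2 ^ k / 2 - 2 ^ k + 1) \<le> expected_recourse M (\<sigma> @ \<tau>)"
  using assms(2-)
proof (induction k arbitrary: \<sigma> a)
  case 0
  then show ?case by (intro exI[of _ "[]"] exI[of _ "[a]"]) auto
next
  case (Suc k)
  let ?inc = "incremental_seqs n 2"
  \<comment> \<open>The block consists of two halves of \<open>V\<close> vertices each and the
    joining vertex \<open>a + 2 * V\<close>; that \<open>V\<close> is odd is what the parity
    argument requires.\<close>
  define V :: nat where "V = 2 ^ Suc k - 1"
  have V: "2 ^ Suc (Suc k) - 1 = 2 * V + 1" "2 ^ Suc k - 2 = V - 1" "odd V" "0 < V"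
    "real V = 2 * 2 ^ k - 1"
  proof -
    obtain t where "(2::nat) ^ k = Suc t" using not0_implies_Suc[of "2 ^ k"] by auto
    then show "2 ^ Suc (Suc k) - 1 = 2 * V + 1" "2 ^ Suc k - 2 = V - 1" "odd V" "0 < V"
      unfolding V_def power_Suc by simp_all
    show "real V = 2 * 2 ^ k - 1" by (simp add: V_def of_nat_diff)
  qed
  have an: "a + (2 * V + 1) \<le> n" using Suc.prems(2) unfolding V .
  have free: "e \<inter> {a..<a + (2 * V + 1)} = {}" if "e \<in> edges_after \<sigma>" for e
    using Suc.prems(3)[OF that] unfolding V .
  note IH = Suc.IH[folded V_def, unfolded V(2)]
  have "\<exists>\<tau> P. \<sigma> @ \<tau> \<in> ?inc \<and> length \<tau> = V - 1 \<and> distinct P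
    \<and> set P = {a..<a + V} \<and> edges_after (\<sigma> @ \<tau>) = edges_after \<sigma> \<union> path_edges P
    \<and> expected_recourse M \<sigma> + (real k * 2 ^ k / 2 - 2 ^ k + 1) \<le> expected_recourse M (\<sigma> @ \<tau>)"
  proof (rule IH)
    show "e \<inter> {a..<a + V} = {}" if "e \<in> edges_after \<sigma>" for e
      using free[OF that] by (auto simp: disjoint_iff)
  qed (use Suc.prems(1) an in auto)
  then obtain \<tau>1 P where 1: "\<sigma> @ \<tau>1 \<in> ?inc" "length \<tau>1 = V - 1" "distinct P"
    "set P = {a..<a + V}" "edges_after (\<sigma> @ \<tau>1) = edges_after \<sigma> \<union> path_edges P"
    "expected_recourse M \<sigma> + (real k * 2 ^ k / 2 - 2 ^ k + 1) \<le> expected_recourse M (\<sigma> @ \<tau>1)"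
    by blast
  \<comment> \<open>The second half is built after the first, on the adjacent interval. Its recourse
    is counted from \<open>\<sigma> @ \<tau>1\<close> on, so the two gains add up.\<close>
  have "\<exists>\<tau> Q. (\<sigma> @ \<tau>1) @ \<tau> \<in> ?inc \<and> length \<tau> = V - 1 \<and> distinct Q
    \<and> set Q = {a + V..<a + V + V} \<and> edges_after ((\<sigma> @ \<tau>1) @ \<tau>) = edges_after (\<sigma> @ \<tau>1) \<union> path_edges Q
    \<and> expected_recourse M (\<sigma> @ \<tau>1) + (real k * 2 ^ k / 2 - 2 ^ k + 1)
      \<le> expected_recourse M ((\<sigma> @ \<tau>1) @ \<tau>)"
  proof (rule IH)
    show "e \<inter> {a + V..<a + V + V} = {}" if "e \<in> edges_after (\<sigma> @ \<tau>1)" for e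
    proof (cases "e \<in> edges_after \<sigma>")
      case True
      from free[OF this] show ?thesis by (auto simp: disjoint_iff)
    next
      case False
      then have "e \<subseteq> {a..<a + V}" using that path_edges_subset[of e P] unfolding 1(4,5) by blast
      then show ?thesis by auto
    qed
  qed (use 1(1) an in auto)
  then obtain \<tau>2 Q where 2: "(\<sigma> @ \<tau>1) @ \<tau>2 \<in> ?inc" "length \<tau>2 = V - 1" "distinct Q"
    "set Q = {a + V..<a + V + V}"
    "edges_after ((\<sigma> @ \<tau>1) @ \<tau>2) = edges_after (\<sigma> @ \<tau>1) \<union> path_edges Q"
    "expected_recourse M (\<sigma> @ \<tau>1) + (real k * 2 ^ k / 2 - 2 ^ k + 1)
      \<le> expected_recourse M ((\<sigma> @ \<tau>1) @ \<tau>2)"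
    by blast
  define x where "x = a + V + V"
  define \<rho> where "\<rho> = (\<sigma> @ \<tau>1) @ \<tau>2"
  have len: "length P = V" "length Q = V"
    using distinct_card[OF 1(3)] distinct_card[OF 2(3)] 1(4) 2(4) by simp_all
  have all: "set (P @ Q @ [x]) = {a..<a + (2 * V + 1)}"
    by (auto simp: 1(4) 2(4) x_def)
  have dyn: "\<sigma> \<in> fully_dynamic_seqs n 2"
    using Suc.prems(1) by (simp add: incremental_seqs_def)
  define s0 where "s0 = [Insert {x, last P}, Insert {hd Q, x}]"
  define s1 where "s1 = [Insert {last P, hd Q}, Insert {x, last Q}]"
  have prems: "\<rho> \<in> ?inc" "edges_after \<rho> = edges_after \<sigma> \<union> path_edges P \<union> path_edges Q"
    "\<And>e. e \<in> edges_after \<sigma> \<Longrightarrow> e \<inter> set (P @ Q @ [x]) = {}" "P \<noteq> []" "Q \<noteq> []"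
    "distinct (P @ Q @ [x])" "set (P @ Q @ [x]) \<subseteq> {..<n}"
    subgoal using 2(1) by (simp add: \<rho>_def)
    subgoal using 1(5) 2(5) by (simp add: \<rho>_def)
    subgoal unfolding all by (rule free)
    subgoal using len V by auto
    subgoal using len V by auto
    subgoal using 1(3,4) 2(3,4) by (auto simp: x_def)
    subgoal unfolding all using an by auto
    done
  note merge = merge_paths[OF prems(1,2) finite_edges_after fully_dynamic_seqs_invariant(2)[OF dyn] prems(3-),
      folded s0_def s1_def]
  have int: "integrable M (\<lambda>A. real (algorithm_recourse A \<mu>))" if "\<mu> \<in> ?inc" for \<mu>
    by (rule algorithm_recourse_integrable[OF M _ _ that]) (auto simp: incremental_seqs_def)
  interpret prob_space M using M by (simp add: randomized_algorithm_def)
  have "2 * expected_recourse M \<rho> + real (V - 1)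
      = (\<integral>A. 2 * real (algorithm_recourse A \<rho>) + real (V - 1) \<partial>M)"
    using int[OF prems(1)] by (simp add: expected_recourse_def prob_space)
  also have "\<dots> \<le> (\<integral>A. real (algorithm_recourse A (\<rho> @ s0)) + real (algorithm_recourse A (\<rho> @ s1)) \<partial>M)"
  proof (rule integral_mono)
    show "integrable M (\<lambda>A. 2 * real (algorithm_recourse A \<rho>) + real (V - 1))"
      using int[OF prems(1)] by simp
    show "integrable M (\<lambda>A. real (algorithm_recourse A (\<rho> @ s0)) + real (algorithm_recourse A (\<rho> @ s1)))"
      using int[OF merge(1)] int[OF merge(2)] by simp
    fix A assume "A \<in> space M"
    then have "2 * algorithm_recourse A \<rho> + min (length P - 1) (length Q - 1)
        \<le> algorithm_recourse A (\<rho> @ s0) + algorithm_recourse A (\<rho> @ s1)"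
      using M len V by (intro merge(5)) (auto simp: randomized_algorithm_def)
    then show "2 * real (algorithm_recourse A \<rho>) + real (V - 1)
        \<le> real (algorithm_recourse A (\<rho> @ s0)) + real (algorithm_recourse A (\<rho> @ s1))"
      using len by simp
  qed
  also have "\<dots> = expected_recourse M (\<rho> @ s0) + expected_recourse M (\<rho> @ s1)"
    using int[OF merge(1)] int[OF merge(2)] by (simp add: expected_recourse_def)
  finally have avg: "2 * expected_recourse M \<rho> + real (V - 1)
      \<le> expected_recourse M (\<rho> @ s0) + expected_recourse M (\<rho> @ s1)" .
  \<comment> \<open>At least one variant reaches the average. The choice depends on the distribution
    \<open>M\<close> only, so the sequence remains oblivious to the random choices.\<close>
  obtain s R where s: "\<rho> @ s \<in> ?inc" "length s = 2" "distinct R" "set R = set (P @ Q @ [x])"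
    "edges_after (\<rho> @ s) = edges_after \<sigma> \<union> path_edges R"
    "expected_recourse M \<rho> + real (V - 1) / 2 \<le> expected_recourse M (\<rho> @ s)"
  proof (cases "expected_recourse M \<rho> + real (V - 1) / 2 \<le> expected_recourse M (\<rho> @ s0)")
    case True
    show ?thesis
      by (rule that[of s0 "P @ [x] @ Q"]) (use True merge(1,3) prems(6) in \<open>auto simp: s0_def\<close>)
  next
    case False
    show ?thesis
      by (rule that[of s1 "P @ Q @ [x]"]) (use False avg merge(2,4) prems(6) in \<open>auto simp: s1_def\<close>)
  qed
  \<comment> \<open>The guaranteed gain \<open>g\<close> obeys \<open>g 0 = 0\<close> and
    \<open>g (Suc k) = 2 * g k + (2 ^ k - 1)\<close>, which is solved by
    \<open>g k = k * 2 ^ k / 2 - 2 ^ k + 1\<close>.\<close>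
  have "real (V - 1) / 2 = 2 ^ k - 1" using V(4,5) by (simp add: of_nat_diff)
  then have "expected_recourse M \<sigma> + (real (Suc k) * 2 ^ Suc k / 2 - 2 ^ Suc k + 1)
      \<le> expected_recourse M (\<rho> @ s)"
    using 1(6) 2(6)[folded \<rho>_def] s(6) by (simp add: field_simps)
  moreover have "\<rho> @ s = \<sigma> @ (\<tau>1 @ \<tau>2 @ s)" by (simp add: \<rho>_def)
  moreover have "length (\<tau>1 @ \<tau>2 @ s) = 2 ^ Suc (Suc k) - 2"
    using V 1(2) 2(2) s(2) by simp
  ultimately show ?case
    using s(1,3-5) all V(1) by (intro exI[of _ "\<tau>1 @ \<tau>2 @ s"] exI[of _ R]) auto
qed

lemma incremental_lower_bound:
  assumes M: "randomized_algorithm 2 (incremental_seqs n 2) M" and n: "n \<ge> 128"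
  shows "\<exists>\<sigma>\<in>incremental_seqs n 2. expected_amortized_recourse M \<sigma> \<ge> 1 / 8 * ln (real n)"
proof -
  \<comment> \<open>\<open>j\<close> is the binary logarithm of \<open>n\<close> rounded down, so a
    block of \<open>2 ^ j - 1\<close> vertices starting at 0 fits. From \<open>128 = 2 ^ 7\<close>
    follows \<open>j = Suc k\<close> with \<open>k \<ge> 6\<close>.\<close>
  obtain j where j: "2 ^ j \<le> n" "n < 2 ^ (j + 1)"
    using ex_power_ivl1[of 2 n] n by auto
  have "7 \<le> j"
  proof (rule ccontr)
    assume "\<not> 7 \<le> j"
    then have "(2::nat) ^ (j + 1) \<le> 2 ^ 7" by (intro power_increasing) auto
    with j n show False by simp
  qed
  then obtain k where k: "j = Suc k" "6 \<le> k" by (cases j) auto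
  have "0 + (2 ^ Suc k - 1) \<le> n" using j(1) unfolding k(1) by linarith
  then obtain \<tau> where \<tau>: "\<tau> \<in> incremental_seqs n 2" "length \<tau> = 2 ^ Suc k - 2"
    "expected_recourse M [] + (real k * 2 ^ k / 2 - 2 ^ k + 1) \<le> expected_recourse M \<tau>"
    using incremental_block[OF M, of "[]" 0 k] by fastforce
  have "n \<le> 2 ^ (k + 2)" using j(2) k(1) by simp
  then have "real n \<le> 2 ^ (k + 2)" by (metis of_nat_le_iff of_nat_numeral of_nat_power)
  then have "ln (real n) \<le> ln (2 ^ (k + 2))" using n by (subst ln_le_cancel_iff) auto
  also have "\<dots> = real (k + 2) * ln 2" by (rule ln_realpow)
  also have "\<dots> \<le> real (k + 2) * 1" by (intro mult_left_mono) (auto intro: less_imp_le ln_2_less_1)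
  finally have ln: "ln (real n) \<le> real k + 2" by simp
  have len: "real (length \<tau>) \<le> 2 * 2 ^ k" "0 < length \<tau>"
  proof -
    have "(2::nat) ^ 6 \<le> 2 ^ k" using k by (intro power_increasing) auto
    then show "0 < length \<tau>" by (simp add: \<tau>(2))
    have "length \<tau> \<le> 2 * 2 ^ k" by (simp add: \<tau>(2))
    then show "real (length \<tau>) \<le> 2 * 2 ^ k"
      by (metis of_nat_le_iff of_nat_mult of_nat_numeral of_nat_power)
  qed
  \<comment> \<open>At most \<open>2 * 2 ^ k\<close> updates cost at least
    \<open>(k / 2 - 1) * 2 ^ k\<close> in expectation. Per update this is at least
    \<open>(k + 2) / 8\<close> as soon as \<open>k \<ge> 6\<close>, whence the constants 1/8 and
    128.\<close>
  have "1 / 8 * ln (real n) * real (length \<tau>) \<le> (real k + 2) / 8 * (2 * 2 ^ k)"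
    using ln len n by (intro mult_mono) auto
  also have "\<dots> = (real k + 2) / 4 * 2 ^ k" by simp
  also have "\<dots> \<le> (real k / 2 - 1) * 2 ^ k" using k by (intro mult_right_mono) auto
  also have "\<dots> \<le> expected_recourse M \<tau>"
    using \<tau>(3) by (simp add: expected_recourse_def algebra_simps)
  finally show ?thesis
    using \<tau>(1) len(2) by (intro bexI[of _ \<tau>]) (simp_all add: expected_amortized_recourse_eq field_simps)
qed

section \<open>Lower bound in the fully dynamic model\<close>

text \<open>\<open>P @ Q\<close> and \<open>Q @ P\<close> arise from one odd cycle by omitting
  different edges. In the first, \<open>Q\<close> is shifted by \<open>length P\<close> against
  \<open>P\<close>; in the second, \<open>P\<close> by \<open>length Q\<close> against
  \<open>Q\<close>. As the lengths have an odd sum, the relative color changes and one path is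
  recolored entirely.\<close>

lemma rotate_path:
  fixes P Q
  defines "s \<equiv> [Delete {last P, hd Q}, Insert {last Q, hd P}]"
  assumes \<sigma>: "\<sigma> \<in> fully_dynamic_seqs n 2" and E: "edges_after \<sigma> = path_edges (P @ Q)"
    and ne: "P \<noteq> []" "Q \<noteq> []" and dist: "distinct (P @ Q)" and less: "set (P @ Q) \<subseteq> {..<n}"
  shows "\<sigma> @ s \<in> fully_dynamic_seqs n 2" "edges_after (\<sigma> @ s) = path_edges (Q @ P)"
    and "\<lbrakk>odd (length P + length Q);
        \<And>\<rho>. \<rho> \<in> fully_dynamic_seqs n 2 \<Longrightarrow> proper_coloring 2 (edges_after \<rho>) (A \<rho>)\<rbrakk>
      \<Longrightarrow> algorithm_recourse A \<sigma> + min (length P - 1) (length Q - 1)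
        \<le> algorithm_recourse A (\<sigma> @ s)"
proof -
  let ?F = "path_edges P \<union> path_edges Q"
  have ends: "last P \<in> set P" "hd P \<in> set P" "last Q \<in> set Q" "hd Q \<in> set Q"
    using ne by auto
  have new: "{last P, hd Q} \<notin> ?F" using ends dist by (auto dest!: path_edges_subset)
  have split: "\<sigma> @ [u, v] = (\<sigma> @ [u]) @ [v]" for u v :: update by simp
  have E1: "edges_after (\<sigma> @ [Delete {last P, hd Q}]) = ?F"
    using new by (simp add: E path_edges_append[OF ne])
  have dist': "distinct (Q @ P)" using dist by auto
  \<comment> \<open>All edges fit on the single path \<open>Q @ P\<close>, so the disjoint rest
    \<open>E0\<close> is empty.\<close>
  have "valid_update n 2 ?F (Insert {last Q, hd P})"
    by (rule valid_insert[where S = "set Q" and R = "Q @ P" and ?E0.0 = "{}"])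
      (use ends dist less in \<open>auto simp: path_edges_append[OF ne(2,1)] degree_at_def dest: path_edges_memD\<close>)
  then show mem: "\<sigma> @ s \<in> fully_dynamic_seqs n 2"
    unfolding s_def split fully_dynamic_seqs_snoc E1
    using \<sigma> by (simp add: E path_edges_append[OF ne])
  show E2: "edges_after (\<sigma> @ s) = path_edges (Q @ P)"
    unfolding s_def split edges_after_snoc[of "\<sigma> @ _"] E1
    by (auto simp: path_edges_append[OF ne(2,1)])
  assume odd: "odd (length P + length Q)"
    and proper: "\<And>\<rho>. \<rho> \<in> fully_dynamic_seqs n 2 \<Longrightarrow> proper_coloring 2 (edges_after \<rho>) (A \<rho>)"
  obtain b where b: "phase (A \<sigma>) (P @ Q) b"
    using proper_coloring_phase[OF proper[OF \<sigma>] _ dist] E by blast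
  obtain d where d: "phase (A (\<sigma> @ s)) (Q @ P) d"
    using proper_coloring_phase[OF proper[OF mem] _ dist'] E2 by blast
  have "min (length P - 1) (length Q - 1) \<le> card {f \<in> ?F. A \<sigma> f \<noteq> A (\<sigma> @ s) f}"
    by (rule card_recolored_ge[OF _ _ phase_append_left[OF b] phase_append_right[OF b]
          phase_append_right[OF d] phase_append_left[OF d]]) (use dist odd in auto)
  moreover have "algorithm_recourse A \<sigma> + card {f \<in> ?F. A \<sigma> f \<noteq> A (\<sigma> @ s) f}
      \<le> algorithm_recourse A (\<sigma> @ s)"
  proof (rule algorithm_recourse_append_ge)
    fix i assume "i \<le> length s"
    then consider "i = 0" | "i = 1" | "i = 2" by (auto simp: s_def le_Suc_eq)
    then show "?F \<subseteq> edges_after (\<sigma> @ take i s)"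
    proof cases
      case 1
      then show ?thesis by (auto simp: E path_edges_append[OF ne])
    next
      case 2
      then show ?thesis using E1 by (simp add: s_def)
    next
      case 3
      then have "take i s = s" by (simp add: s_def)
      then show ?thesis by (auto simp: E2 path_edges_append[OF ne(2,1)])
    qed
  qed simp
  ultimately show "algorithm_recourse A \<sigma> + min (length P - 1) (length Q - 1)
      \<le> algorithm_recourse A (\<sigma> @ s)" by linarith
qed

lemma rotate_path_iterate:
  assumes "\<sigma> \<in> fully_dynamic_seqs n 2" "edges_after \<sigma> = path_edges (P @ Q)"
    and "P \<noteq> []" "Q \<noteq> []" "distinct (P @ Q)" "set (P @ Q) \<subseteq> {..<n}" "odd (length P + length Q)"
  shows "\<exists>\<tau>. \<sigma> @ \<tau> \<in> fully_dynamic_seqs n 2 \<and> length \<tau> = 2 * r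
    \<and> (\<forall>A. (\<forall>\<rho>\<in>fully_dynamic_seqs n 2. proper_coloring 2 (edges_after \<rho>) (A \<rho>))
        \<longrightarrow> algorithm_recourse A \<sigma> + r * min (length P - 1) (length Q - 1)
          \<le> algorithm_recourse A (\<sigma> @ \<tau>))"
  using assms
proof (induction r arbitrary: \<sigma> P Q)
  case 0
  then show ?case by (intro exI[of _ "[]"]) auto
next
  case (Suc r)
  define s where "s = [Delete {last P, hd Q}, Insert {last Q, hd P}]"
  note rot = rotate_path[OF Suc.prems(1-6), folded s_def]
  \<comment> \<open>The next rotation starts from \<open>Q @ P\<close>, so the induction hypothesis
    is applied with the two paths exchanged; the minimum is symmetric.\<close>
  obtain \<tau> where \<tau>: "(\<sigma> @ s) @ \<tau> \<in> fully_dynamic_seqs n 2" "length \<tau> = 2 * r"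
    "\<And>A. (\<forall>\<rho>\<in>fully_dynamic_seqs n 2. proper_coloring 2 (edges_after \<rho>) (A \<rho>))
      \<Longrightarrow> algorithm_recourse A (\<sigma> @ s) + r * min (length Q - 1) (length P - 1)
        \<le> algorithm_recourse A ((\<sigma> @ s) @ \<tau>)"
    using Suc.IH[OF rot(1,2) Suc.prems(4,3)] Suc.prems(5-7) by (auto simp: Int_commute add.commute)
  have "algorithm_recourse A \<sigma> + Suc r * min (length P - 1) (length Q - 1)
      \<le> algorithm_recourse A (\<sigma> @ s @ \<tau>)"
    if "\<forall>\<rho>\<in>fully_dynamic_seqs n 2. proper_coloring 2 (edges_after \<rho>) (A \<rho>)" for A
    using \<tau>(3)[OF that] rot(3)[OF Suc.prems(7), of A] that by (simp add: min.commute)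
  then show ?case
    using \<tau>(1,2) by (intro exI[of _ "s @ \<tau>"]) (simp add: s_def)
qed

text \<open>Supplies the starting path for the rotations; each insertion attaches the still isolated
  vertex \<open>Suc j\<close>.\<close>

lemma build_path:
  assumes "j < n"
  shows "\<exists>\<sigma>\<in>fully_dynamic_seqs n 2. length \<sigma> = j \<and> edges_after \<sigma> = path_edges [0..<Suc j]"
  using assms
proof (induction j)
  case 0
  then show ?case by (intro bexI[of _ "[]"]) simp_all
next
  case (Suc j)
  then obtain \<sigma> where \<sigma>: "\<sigma> \<in> fully_dynamic_seqs n 2" "length \<sigma> = j"
    "edges_after \<sigma> = path_edges [0..<Suc j]" by auto
  have "[0..<Suc (Suc j)] = [0..<Suc j] @ [Suc j]" by simp
  then have path: "path_edges [0..<Suc (Suc j)] = insert {Suc j, j} (path_edges [0..<Suc j])"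
    using path_edges_append[of "[0..<Suc j]" "[Suc j]"] by (simp add: insert_commute)
  have "valid_update n 2 (edges_after \<sigma>) (Insert {Suc j, j})"
  proof (rule valid_insert[where S = "{Suc j}" and R = "[0..<Suc (Suc j)]" and ?E0.0 = "{}"])
    show "e \<inter> {Suc j} = {} \<or> e \<subseteq> {Suc j}" if "e \<in> edges_after \<sigma>" for e
      using that path_edges_subset[of e "[0..<Suc j]"] \<sigma>(3) by auto
    show "insert {Suc j, j} (edges_after \<sigma>) \<subseteq> {} \<union> path_edges [0..<Suc (Suc j)]"
      by (simp only: path \<sigma>(3)) simp
  qed (use Suc.prems in \<open>auto simp: degree_at_def\<close>)
  then show ?case
    using \<sigma> by (intro bexI[of _ "\<sigma> @ [Insert {Suc j, j}]"]) (simp_all only: path fully_dynamic_seqs_snoc, auto)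
qed

lemma fully_dynamic_lower_bound:
  assumes M: "randomized_algorithm 2 (fully_dynamic_seqs n 2) M" and n: "n \<ge> 12"
  shows "\<exists>\<sigma>\<in>fully_dynamic_seqs n 2. expected_amortized_recourse M \<sigma> \<ge> 1 / 12 * real n"
proof -
  \<comment> \<open>\<open>N = 4 * m + 3\<close> is odd, at most \<open>n\<close> and at least
    \<open>n - 3\<close>. It splits into pieces of \<open>2 * m + 1\<close> and
    \<open>2 * m + 2\<close> vertices, so a rotation costs at least \<open>2 * m\<close>.\<close>
  define m where "m = (n - 3) div 4"
  define N where "N = 4 * m + 3"
  define P where "P = [0..<2 * m + 1]"
  define Q where "Q = [2 * m + 1..<N]"
  have N: "N \<le> n" "0 < N" "n \<le> 4 * m + 6" using n by (auto simp: N_def m_def)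
  have PQ: "P @ Q = [0..<N]"
  proof -
    have "N = (2 * m + 1) + (2 * m + 2)" by (simp add: N_def)
    then show ?thesis
      unfolding P_def Q_def by (metis upt_add_eq_append zero_le)
  qed
  have "N - 1 < n" "Suc (N - 1) = N" using N by auto
  then obtain \<sigma> where \<sigma>: "\<sigma> \<in> fully_dynamic_seqs n 2" "length \<sigma> = N - 1"
    "edges_after \<sigma> = path_edges (P @ Q)"
    using build_path[of "N - 1" n] unfolding PQ by metis
  have len: "length P = 2 * m + 1" "length Q = 2 * m + 2"
    by (auto simp: P_def Q_def N_def)
  have ne: "P \<noteq> []" "Q \<noteq> []" using len by auto
  have "distinct (P @ Q)" "set (P @ Q) \<subseteq> {..<n}" "odd (length P + length Q)"
    unfolding PQ using N len by auto
  \<comment> \<open>\<open>N\<close> rotations take \<open>2 * N\<close> updates, which outweighs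
    the \<open>N - 1\<close> updates spent on building the path.\<close>
  from rotate_path_iterate[OF \<sigma>(1,3) ne this, of N]
  obtain \<tau> where \<tau>: "\<sigma> @ \<tau> \<in> fully_dynamic_seqs n 2" "length \<tau> = 2 * N"
    "\<And>A. (\<forall>\<rho>\<in>fully_dynamic_seqs n 2. proper_coloring 2 (edges_after \<rho>) (A \<rho>))
      \<Longrightarrow> algorithm_recourse A \<sigma> + N * min (length P - 1) (length Q - 1)
        \<le> algorithm_recourse A (\<sigma> @ \<tau>)"
    by blast
  interpret prob_space M using M by (simp add: randomized_algorithm_def)
  have "real (N * (2 * m)) = (\<integral>A. real (N * (2 * m)) \<partial>M)"
    by (simp add: prob_space)
  also have "\<dots> \<le> expected_recourse M (\<sigma> @ \<tau>)"
    unfolding expected_recourse_def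
  proof (rule integral_mono)
    show "integrable M (\<lambda>A. real (algorithm_recourse A (\<sigma> @ \<tau>)))"
      by (rule algorithm_recourse_integrable[OF M _ order_refl \<tau>(1)]) simp
    fix A assume "A \<in> space M"
    then have "algorithm_recourse A \<sigma> + N * min (length P - 1) (length Q - 1)
        \<le> algorithm_recourse A (\<sigma> @ \<tau>)"
      using M by (intro \<tau>(3)) (simp add: randomized_algorithm_def)
    then show "real (N * (2 * m)) \<le> real (algorithm_recourse A (\<sigma> @ \<tau>))"
      unfolding of_nat_le_iff len by simp
  qed simp
  finally have lower: "real N * (2 * real m) \<le> expected_recourse M (\<sigma> @ \<tau>)" by simp
  have "real (length (\<sigma> @ \<tau>)) \<le> 3 * real N" "0 < length (\<sigma> @ \<tau>)"
    using \<sigma>(2) \<tau>(2) N(2) by auto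
  \<comment> \<open>Follows from \<open>n \<le> 4 * m + 6\<close> and the threshold
    \<open>n \<ge> 12\<close>. A cost of \<open>2 * m * N\<close> over at most \<open>3 * N\<close>
    updates is \<open>2 * m / 3\<close> per update, hence at least \<open>n / 12\<close>.\<close>
  moreover have "real n \<le> 8 * real m" using N(3) n by linarith
  ultimately have "1 / 12 * real n * real (length (\<sigma> @ \<tau>)) \<le> (8 * real m) / 12 * (3 * real N)"
    by (intro mult_mono) auto
  also have "\<dots> = real N * (2 * real m)" by simp
  also note lower
  finally show ?thesis
    using \<tau>(1) \<open>0 < length (\<sigma> @ \<tau>)\<close>
    by (intro bexI[of _ "\<sigma> @ \<tau>"])
      (simp_all only: expected_amortized_recourse_eq pos_le_divide_eq of_nat_0_less_iff)
qed

theorem theorem3p11: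
  shows
    "(\<exists>C>0. \<forall>n\<ge>2. \<forall>\<sigma>\<in>incremental_seqs n 2. \<forall>c.
        greedy_run 2 \<sigma> c \<longrightarrow> amortized_recourse \<sigma> c \<le> C * ln (real n)) \<and>
     (\<exists>C>0. \<forall>n\<ge>1. \<forall>\<sigma>\<in>fully_dynamic_seqs n 2. \<forall>c.
        greedy_run 2 \<sigma> c \<longrightarrow> amortized_recourse \<sigma> c \<le> C * real n) \<and>
     (\<exists>c>0. \<exists>n0. \<forall>n\<ge>n0. \<forall>M. randomized_algorithm 2 (incremental_seqs n 2) M \<longrightarrow>
        (\<exists>\<sigma>\<in>incremental_seqs n 2. expected_amortized_recourse M \<sigma> \<ge> c * ln (real n))) \<and>
     (\<exists>c>0. \<exists>n0. \<forall>n\<ge>n0. \<forall>M. randomized_algorithm 2 (fully_dynamic_seqs n 2) M \<longrightarrow>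
        (\<exists>\<sigma>\<in>fully_dynamic_seqs n 2. expected_amortized_recourse M \<sigma> \<ge> c * real n))"
proof (intro conjI)
  show "\<exists>C>0. \<forall>n\<ge>2. \<forall>\<sigma>\<in>incremental_seqs n 2. \<forall>c.
      greedy_run 2 \<sigma> c \<longrightarrow> amortized_recourse \<sigma> c \<le> C * ln (real n)"
    using greedy_amortized_le by (intro exI[of _ "1 / ln 2"]) auto
  show "\<exists>C>0. \<forall>n\<ge>1. \<forall>\<sigma>\<in>fully_dynamic_seqs n 2. \<forall>c.
      greedy_run 2 \<sigma> c \<longrightarrow> amortized_recourse \<sigma> c \<le> C * real n"
    using amortized_recourse_le by (intro exI[of _ 1]) auto
  show "\<exists>c>0. \<exists>n0. \<forall>n\<ge>n0. \<forall>M. randomized_algorithm 2 (incremental_seqs n 2) M \<longrightarrow>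
      (\<exists>\<sigma>\<in>incremental_seqs n 2. expected_amortized_recourse M \<sigma> \<ge> c * ln (real n))"
    using incremental_lower_bound
    by (intro exI[of _ "1 / 8"] conjI exI[of _ 128] allI impI) simp_all
  show "\<exists>c>0. \<exists>n0. \<forall>n\<ge>n0. \<forall>M. randomized_algorithm 2 (fully_dynamic_seqs n 2) M \<longrightarrow>
      (\<exists>\<sigma>\<in>fully_dynamic_seqs n 2. expected_amortized_recourse M \<sigma> \<ge> c * real n)"
    using fully_dynamic_lower_bound
    by (intro exI[of _ "1 / 12"] conjI exI[of _ 12] allI impI) simp_all
qed

end
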